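(* Let $(\mathbf{v},\mathbf{B})\in\mathcal{D}_n$ be such that there does not exist a Laguerre diagram compatible with $(\mathbf{v},\mathbf{B})$, i.e. there is no $\mathbf{X}\in\mathbb{D}_n$ with $c_i(\mathbf{X};\mathbf{v})=b_i$ for all $i\in\{1,\ldots,n\}$. Fix $t\in\mathbb{R}^d$, $\mathbf{T}=(t,\ldots,t)\in\mathbb{R}^{nd}$ and $R>0$, and define the compact set $B=\{\mathbf{X}\in\mathbb{R}^{nd} : |\mathbf{X}-\mathbf{T}|\le R\}$. Let $\mathbf{X}^*\in B$ be a global maximiser of the concave function $H=H(\,\cdot\,;(\mathbf{v},\mathbf{B}))$ on $B$. Assume that $\mathbf{X}^*\in\mathbb{D}_n$, that $H$ is 3-times continuously differentiable in a neighbourhood of $\mathbf{X}^*$, and that $\dim(\ker(D^2H(\mathbf{X}^* )))=1+d$. Then $\mathbf{X}^*$ is a local minimiser on $\mathbb{D}_n$ of the function $$f(\mathbf{X})=\sum_{i=1}^n v_i^2\,|c_i(\mathbf{X};\mathbf{v})-b_i|^2 .$$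
   Context: Let $d\ge 2$ and let $\Omega\subset\mathbb{R}^d$ be a non-empty, convex, bounded set equal to the closure of its interior. For a Lebesgue-measurable $A\subseteq\mathbb{R}^d$, $\mathrm{vol}(A)$ is its $d$-dimensional Lebesgue measure and, if $\mathrm{vol}(A)\neq 0$, $\sigma(A)=\frac{1}{\mathrm{vol}(A)}\int_A x\,dx$ is its centroid. $\mathbb{D}_n=\{\mathbf{X}=(x_1,\ldots,x_n)\in(\mathbb{R}^d)^n : x_i\ne x_j \text{ for all } i\neq j\}$ is the set of distinct seeds; $(\mathbb{R}^d)^n$ is identified with $\mathbb{R}^{nd}$, and $|\cdot|$ is the Euclidean norm. For $\mathbf{X}\in\mathbb{D}_n$ and $\mathbf{w}=(w_1,\ldots,w_n)\in\mathbb{R}^n$, the $i$-th Laguerre cell is $$\mathrm{Lag}_i(\mathbf{X},\mathbf{w})=\{x\in\Omega : |x-x_i|^2-w_i\le |x-x_j|^2-w_j\ \forall j\in\{1,\ldots,n\}\}.$$ $\mathbb{V}_n=\{\mathbf{v}\in(0,\infty)^n : \sum_{i=1}^n v_i=\mathrm{vol}(\Omega)\}$. For $\mathbf{X}\in\mathbb{D}_n$ and $\mathbf{v}\in\mathbb{V}_n$, it is known that there exists $\mathbf{w}\in\mathbb{R}^n$, unique up to adding the same constant to all components (and made unique by requiring $w_n=0$), such that $\mathrm{vol}(\mathrm{Lag}_i(\mathbf{X},\mathbf{w}))=v_i$ for all $i$; denote it $\mathbf{w}^*(\mathbf{X};\mathbf{v})$. Set $L_i(\mathbf{X};\mathbf{v})=\mathrm{Lag}_i(\mathbf{X},\mathbf{w}^*(\mathbf{X};\mathbf{v}))$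 and $c_i(\mathbf{X};\mathbf{v})=\sigma(L_i(\mathbf{X};\mathbf{v}))$. The set of compatible data is $$\mathcal{D}_n=\Big\{(\mathbf{v},\mathbf{B})=((v_1,\ldots,v_n),(b_1,\ldots,b_n))\in\mathbb{V}_n\times\Omega^n : \sum_{i=1}^n v_ib_i=\mathrm{vol}(\Omega)\,\sigma(\Omega)\Big\}.$$ For $\mathbf{X}\in\mathbb{R}^{nd}$ (seeds not necessarily distinct) and $\mathbf{v}\in\mathbb{V}_n$, let $\nu(\mathbf{X},\mathbf{v})=\sum_{i=1}^n v_i\delta_{x_i}$, let $\mathcal{L}^d_\Omega$ be Lebesgue measure restricted to $\Omega$, and let $W_2$ be the quadratic Wasserstein distance: $$W_2^2(\mathcal{L}^d_\Omega,\nu(\mathbf{X},\mathbf{v}))=\inf_T\int_\Omega|x-T(x)|^2\,dx,$$ the infimum being over measurable maps $T:\Omega\to\{x_1,\ldots,x_n\}$ pushing $\mathcal{L}^d_\Omega$ forward to $\nu(\mathbf{X},\mathbf{v})$. For $(\mathbf{v},\mathbf{B})\in\mathcal{D}_n$ define $H(\,\cdot\,;(\mathbf{v},\mathbf{B})):\mathbb{R}^{nd}\to\mathbb{R}$ by $$H(\mathbf{X};(\mathbf{v},\mathbf{B}))=\tfrac12 W_2^2(\mathcal{L}^d_\Omega,\nu(\mathbf{X},\mathbf{v}))-\tfrac12\sum_{i=1}^n v_i|x_i|^2+\sum_{i=1}^n v_i\,x_i\cdot b_i-\tfrac12\int_\Omega|x|^2\,dx.$$ *)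

theory Defs
  imports "HOL-Analysis.Analysis"
begin

text \<open>
  \<open>\<real>\<^sup>d\<close> is \<open>real^'d\<close>, and \<open>n\<close>-tuples of points of \<open>\<real>\<^sup>d\<close> are elements of \<open>real^'d^'n\<close>, whose
  library norm is the Euclidean norm of \<open>\<real>\<^sup>n\<^sup>d\<close>. The index type \<open>'n\<close> is finite; it is linearly
  ordered only so that there is a last index, \<open>Max UNIV\<close>, at which weights are normalised.
\<close>

definition vol :: "(real^'d) set \<Rightarrow> real" where
  "vol A = measure lebesgue A"

definition centroid :: "(real^'d) set \<Rightarrow> real^'d" where
  "centroid A = (1 / vol A) *\<^sub>R (LINT x:A|lebesgue. x)"

definition distinct_seeds :: "(real^'d^'n) set" where
  "distinct_seeds = {X. \<forall>i j. i \<noteq> j \<longrightarrow> X $ i \<noteq> X $ j}"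

definition Lag :: "(real^'d) set \<Rightarrow> real^'d^'n \<Rightarrow> real^'n \<Rightarrow> 'n \<Rightarrow> (real^'d) set" where
  "Lag \<Omega> X w i =
     {x \<in> \<Omega>. \<forall>j. (norm (x - X $ i))\<^sup>2 - w $ i \<le> (norm (x - X $ j))\<^sup>2 - w $ j}"

definition target_volumes :: "(real^'d) set \<Rightarrow> (real^'n) set" where
  "target_volumes \<Omega> = {v. (\<forall>i. 0 < v $ i) \<and> (\<Sum>i\<in>UNIV. v $ i) = vol \<Omega>}"

text \<open>
  For \<open>\<Omega>\<close> convex, bounded, non-empty and equal to the closure of its interior, distinct seeds and
  \<open>v \<in> target_volumes \<Omega>\<close>, exactly one weight vector has the property below.
\<close>

definition opt_weights ::
    "(real^'d) set \<Rightarrow> real^'d^('n::{finite,linorder}) \<Rightarrow> real^('n::{finite,linorder}) \<Rightarrow> real^('n::{finite,linorder})" where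
  "opt_weights \<Omega> X v =
     (SOME w. w $ Max UNIV = 0 \<and> (\<forall>i. vol (Lag \<Omega> X w i) = v $ i))"

definition opt_cell ::
    "(real^'d) set \<Rightarrow> real^'d^('n::{finite,linorder}) \<Rightarrow> real^('n::{finite,linorder}) \<Rightarrow> 'n \<Rightarrow> (real^'d) set" where
  "opt_cell \<Omega> X v i = Lag \<Omega> X (opt_weights \<Omega> X v) i"

definition cell_centroid ::
    "(real^'d) set \<Rightarrow> real^'d^('n::{finite,linorder}) \<Rightarrow> real^('n::{finite,linorder}) \<Rightarrow> 'n \<Rightarrow> real^'d" where
  "cell_centroid \<Omega> X v i = centroid (opt_cell \<Omega> X v i)"

definition compatible_data :: "(real^'d) set \<Rightarrow> ((real^'n) \<times> (real^'d^'n)) set" where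
  "compatible_data \<Omega> =
     {(v, b). v \<in> target_volumes \<Omega> \<and> (\<forall>i. b $ i \<in> \<Omega>) \<and>
        (\<Sum>i\<in>UNIV. v $ i *\<^sub>R b $ i) = vol \<Omega> *\<^sub>R centroid \<Omega>}"

text \<open>
  The measure \<open>\<Sum>\<^sub>i v\<^sub>i \<delta>\<^bsub>x\<^sub>i\<^esub>\<close> on \<open>\<real>\<^sup>d\<close>, as the image under \<open>i \<mapsto> x\<^sub>i\<close> of the measure on the index type
  that gives mass \<open>v\<^sub>i\<close> to \<open>i\<close>; see \<open>emeasure_discrete_target\<close>. The seeds may coincide.
\<close>

definition discrete_target :: "real^'d^'n \<Rightarrow> real^'n \<Rightarrow> (real^'d) measure" where
  "discrete_target X v = distr (point_measure UNIV (\<lambda>i. ennreal (v $ i))) borel (\<lambda>i. X $ i)"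

lemma emeasure_discrete_target:
  assumes "A \<in> sets borel"
  shows "emeasure (discrete_target X v) A = (\<Sum>i\<in>UNIV. ennreal (v $ i) * indicator A (X $ i))"
proof -
  have "emeasure (discrete_target X v) A = (\<Sum>i | X $ i \<in> A. ennreal (v $ i))"
    unfolding discrete_target_def
    by (subst emeasure_distr)
      (use assms in \<open>auto simp: measurable_def space_point_measure sets_point_measure
        emeasure_point_measure_finite vimage_def\<close>)
  also have "\<dots> = (\<Sum>i\<in>UNIV. ennreal (v $ i) * indicator A (X $ i))"
    by (rule sum.mono_neutral_cong_left) (auto simp: indicator_def)
  finally show ?thesis .
qed

text \<open>Maps in this set are constrained on \<open>\<Omega>\<close> only; their values off \<open>\<Omega>\<close> are irrelevant.\<close>

definition transport_maps ::
    "(real^'d) set \<Rightarrow> real^'d^'n \<Rightarrow> real^'n \<Rightarrow> (real^'d \<Rightarrow> real^'d) set" where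
  "transport_maps \<Omega> X v =
     {T. T \<in> borel_measurable (lebesgue_on \<Omega>) \<and> T ` \<Omega> \<subseteq> range (\<lambda>i. X $ i) \<and>
         distr (lebesgue_on \<Omega>) borel T = discrete_target X v}"

definition W2_squared :: "(real^'d) set \<Rightarrow> real^'d^'n \<Rightarrow> real^'n \<Rightarrow> real" where
  "W2_squared \<Omega> X v =
     (INF T\<in>transport_maps \<Omega> X v. LINT x:\<Omega>|lebesgue. (norm (x - T x))\<^sup>2)"

definition H_fun ::
    "(real^'d) set \<Rightarrow> (real^'n) \<times> (real^'d^'n) \<Rightarrow> real^'d^'n \<Rightarrow> real" where
  "H_fun \<Omega> = (\<lambda>(v, b) X.
     1/2 * W2_squared \<Omega> X v
     - 1/2 * (\<Sum>i\<in>UNIV. v $ i * (norm (X $ i))\<^sup>2)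
     + (\<Sum>i\<in>UNIV. v $ i * (X $ i \<bullet> b $ i))
     - 1/2 * (LINT x:\<Omega>|lebesgue. (norm x)\<^sup>2))"

text \<open>
  \<open>k\<close>-fold continuous differentiability on an open set: \<open>f\<close> is continuous if \<open>k = 0\<close>; otherwise
  \<open>f\<close> is Frechet differentiable and all its directional derivatives are of class \<open>C\<^sup>k\<^sup>-\<^sup>1\<close>.
\<close>

primrec Ck_on :: "nat \<Rightarrow> ('a::euclidean_space \<Rightarrow> real) \<Rightarrow> 'a set \<Rightarrow> bool" where
  "Ck_on 0 f U \<longleftrightarrow> continuous_on U f"
| "Ck_on (Suc k) f U \<longleftrightarrow>
     (\<forall>x\<in>U. f differentiable (at x)) \<and>
     (\<forall>u. Ck_on k (\<lambda>x. frechet_derivative f (at x) u) U)"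

text \<open>The Hessian as a bilinear form, and the kernel of the linear map it represents.\<close>

definition second_derivative ::
    "('a::euclidean_space \<Rightarrow> real) \<Rightarrow> 'a \<Rightarrow> 'a \<Rightarrow> 'a \<Rightarrow> real" where
  "second_derivative f x u z =
     frechet_derivative (\<lambda>y. frechet_derivative f (at y) z) (at x) u"

definition hessian_kernel :: "('a::euclidean_space \<Rightarrow> real) \<Rightarrow> 'a \<Rightarrow> 'a set" where
  "hessian_kernel f x = {u. \<forall>z. second_derivative f x u z = 0}"

definition local_minimiser_on :: "('a::metric_space \<Rightarrow> real) \<Rightarrow> 'a set \<Rightarrow> 'a \<Rightarrow> bool" where
  "local_minimiser_on f S x \<longleftrightarrow>
     x \<in> S \<and> (\<exists>\<epsilon>>0. \<forall>y\<in>S. dist y x < \<epsilon> \<longrightarrow> f x \<le> f y)"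

end

theory Submission
  imports Defs
begin

text \<open>
  Put \<open>P(X)\<^sub>i = v\<^sub>i (b\<^sub>i - c\<^sub>i(X))\<close>, so that the function to be minimised is \<open>|P(X)|\<^sup>2\<close>. Assigning
  the optimal cells of \<open>X\<close> to the seeds \<open>Y\<close> is a transport map for \<open>Y\<close>, hence \<open>H(Y) \<le> P(X) \<bullet> Y\<close>, and
  Kantorovich duality gives equality for \<open>Y = X\<close>. Thus \<open>P(X\<^sup>*)\<close> is a supergradient of \<open>H\<close> at \<open>X\<^sup>*\<close>, and
  the gradient there by differentiability; moving from the maximiser \<open>X\<^sup>*\<close> towards the point of the ball
  furthest in direction \<open>P(X\<^sup>*)\<close> gives \<open>R |P(X\<^sup>*)| \<le> P(X\<^sup>*) \<bullet> (X\<^sup>* - T)\<close>. Since \<open>P(X) \<bullet> T = 0\<close> for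
  compatible data, every \<open>X\<close> with distinct seeds satisfies
  \<open>R |P(X)| \<ge> P(X) \<bullet> (X\<^sup>* - T) = P(X) \<bullet> X\<^sup>* \<ge> H(X\<^sup>*) = P(X\<^sup>*) \<bullet> (X\<^sup>* - T) \<ge> R |P(X\<^sup>*)|\<close>.
\<close>

section \<open>Power distances and a measurable choice of nearest index\<close>

definition power_dist :: "real^'d^'n \<Rightarrow> real^'n \<Rightarrow> 'n \<Rightarrow> real^'d \<Rightarrow> real" where
  "power_dist X w i x = (norm (x - X $ i))\<^sup>2 - w $ i"

text \<open>Cells overlap along their boundaries. Taking the least minimising index gives a
  single-valued Borel measurable choice, from which transport maps can be built.\<close>

definition nearest ::
    "real^'d^('n::{finite,linorder}) \<Rightarrow> real^('n::{finite,linorder}) \<Rightarrow> real^'d \<Rightarrow> 'n" where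
  "nearest X w x = Min {i. \<forall>j. power_dist X w i x \<le> power_dist X w j x}"

lemma mem_Lag_iff: "x \<in> Lag \<Omega> X w i \<longleftrightarrow> x \<in> \<Omega> \<and> (\<forall>j. power_dist X w i x \<le> power_dist X w j x)"
  by (simp add: Lag_def power_dist_def)

lemma nearest_in: "nearest X w x \<in> {i. \<forall>j. power_dist X w i x \<le> power_dist X w j x}"
proof -
  obtain i where "is_arg_min (\<lambda>i. power_dist X w i x) (\<lambda>i. i \<in> UNIV) i"
    using ex_is_arg_min_if_finite[OF finite_class.finite_UNIV UNIV_not_empty] by blast
  then have "i \<in> {i. \<forall>j. power_dist X w i x \<le> power_dist X w j x}"
    by (simp add: is_arg_min_linorder)
  then show ?thesis
    unfolding nearest_def by (intro Min_in) auto
qed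

lemma nearest_le: "power_dist X w (nearest X w x) x \<le> power_dist X w j x"
  using nearest_in by blast

lemma mem_Lag_nearest: "x \<in> \<Omega> \<Longrightarrow> x \<in> Lag \<Omega> X w (nearest X w x)"
  by (simp add: mem_Lag_iff nearest_le)

text \<open>Finitely many comparisons of power distances, the form from which measurability of
  \<open>nearest\<close> is read off.\<close>

lemma nearest_eq_iff:
  "nearest X w x = i \<longleftrightarrow> (\<forall>j. power_dist X w i x \<le> power_dist X w j x) \<and>
     (\<forall>k\<in>{..<i}. \<not> (\<forall>j. power_dist X w k x \<le> power_dist X w j x))"
  (is "?L \<longleftrightarrow> ?R")
proof
  assume L: ?L
  have "i \<le> k" if "\<forall>j. power_dist X w k x \<le> power_dist X w j x" for k
    unfolding L[symmetric] nearest_def using that by (intro Min_le) auto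
  then show ?R using nearest_le[of X w x] unfolding L by (meson lessThan_iff not_le)
next
  assume R: ?R
  show ?L
    unfolding nearest_def
  proof (rule Min_eqI)
    show "i \<le> k" if "k \<in> {i. \<forall>j. power_dist X w i x \<le> power_dist X w j x}" for k
      using that R by (metis lessThan_iff mem_Collect_eq not_le)
  qed (use R in auto)
qed

lemma power_dist_measurable [measurable]: "power_dist X w i \<in> borel_measurable borel"
  unfolding power_dist_def by measurable

lemma nearest_measurable [measurable]: "nearest X w \<in> borel \<rightarrow>\<^sub>M count_space UNIV"
proof -
  have "nearest X w -` {i} \<inter> space borel \<in> sets borel" for i
  proof -
    have "nearest X w -` {i} \<inter> space borel = {x \<in> space borel. (\<forall>j. power_dist X w i x \<le> power_dist X w j x) \<and>
     (\<forall>k\<in>{..<i}. \<not> (\<forall>j. power_dist X w k x \<le> power_dist X w j x))}"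
      by (simp add: vimage_def nearest_eq_iff)
    also have "\<dots> \<in> sets borel" by measurable
    finally show ?thesis .
  qed
  then show ?thesis by (subst measurable_count_space_eq2) auto
qed

section \<open>Integration over Laguerre cells\<close>

lemma measurable_lebesgue_on:
  fixes f :: "'a::euclidean_space \<Rightarrow> 'b"
  shows "f \<in> borel \<rightarrow>\<^sub>M N \<Longrightarrow> f \<in> lebesgue_on \<Omega> \<rightarrow>\<^sub>M N"
  by (intro measurable_restrict_space1 measurable_completion) simp

lemma set_lint_eq:
  fixes f :: "real^'d \<Rightarrow> 'a::{banach,second_countable_topology}"
  assumes "\<Omega> \<in> sets lebesgue"
  shows "(LINT x:\<Omega>|lebesgue. f x) = (LINT x|lebesgue_on \<Omega>. f x)"
  using assms by (simp add: set_lebesgue_integral_def integral_restrict_space)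

lemma closed_Lag: "closed \<Omega> \<Longrightarrow> closed (Lag \<Omega> X w i)"
proof -
  assume "closed \<Omega>"
  moreover have "Lag \<Omega> X w i = \<Omega> \<inter> {x. \<forall>j. (norm (x - X $ i))\<^sup>2 - w $ i \<le> (norm (x - X $ j))\<^sup>2 - w $ j}"
    by (auto simp: Lag_def)
  ultimately show ?thesis
    by (auto intro!: closed_Int closed_Collect_all closed_Collect_le continuous_intros)
qed

lemma Lag_subset: "Lag \<Omega> X w i \<subseteq> \<Omega>"
  by (auto simp: Lag_def)

text \<open>Where two power distances agree the quadratic terms cancel, leaving a hyperplane with
  normal \<open>2 *\<^sub>R (X $ j - X $ i)\<close>, which is nonzero.\<close>

lemma Lag_overlap_negligible:
  assumes "X $ i \<noteq> X $ j"
  shows "negligible (Lag \<Omega> X w i \<inter> Lag \<Omega> X w j)"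
proof (rule negligible_subset)
  show "negligible {x. (2 *\<^sub>R (X $ j - X $ i)) \<bullet> x = (X $ j \<bullet> X $ j - w $ j) - (X $ i \<bullet> X $ i - w $ i)}"
    using assms by (intro negligible_hyperplane) auto
  show "Lag \<Omega> X w i \<inter> Lag \<Omega> X w j \<subseteq>
    {x. (2 *\<^sub>R (X $ j - X $ i)) \<bullet> x = (X $ j \<bullet> X $ j - w $ j) - (X $ i \<bullet> X $ i - w $ i)}"
  proof
    fix x assume "x \<in> Lag \<Omega> X w i \<inter> Lag \<Omega> X w j"
    then have "(norm (x - X $ i))\<^sup>2 - w $ i = (norm (x - X $ j))\<^sup>2 - w $ j"
      by (auto simp: Lag_def intro: antisym)
    then show "x \<in> {x. (2 *\<^sub>R (X $ j - X $ i)) \<bullet> x = (X $ j \<bullet> X $ j - w $ j) - (X $ i \<bullet> X $ i - w $ i)}"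
      by (simp add: power2_norm_eq_inner inner_diff_left inner_diff_right inner_commute algebra_simps)
  qed
qed

text \<open>A point of cell \<open>i\<close> with another nearest index lies in two cells at once,
  and the finitely many overlaps with cell \<open>i\<close> are null.\<close>

lemma AE_mem_Lag_iff_nearest:
  assumes X: "X \<in> distinct_seeds" and \<Omega>: "\<Omega> \<in> sets lebesgue"
  shows "AE x in lebesgue_on \<Omega>. x \<in> Lag \<Omega> X w i \<longleftrightarrow> nearest X w x = i"
proof -
  have "negligible (\<Union>j\<in>-{i}. Lag \<Omega> X w i \<inter> Lag \<Omega> X w j)"
    using X by (intro negligible_Union) (auto simp: distinct_seeds_def intro!: Lag_overlap_negligible)
  then have "AE x in lebesgue. x \<notin> (\<Union>j\<in>-{i}. Lag \<Omega> X w i \<inter> Lag \<Omega> X w j)"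
    by (intro AE_not_in) (simp add: negligible_iff_null_sets)
  then have "AE x in lebesgue. x \<in> \<Omega> \<longrightarrow> (x \<in> Lag \<Omega> X w i \<longleftrightarrow> nearest X w x = i)"
    by eventually_elim (use mem_Lag_nearest in fastforce)
  then show ?thesis using \<Omega> by (simp add: AE_restrict_space_iff)
qed

lemma integrable_lebesgue_on_bounded:
  fixes f :: "real^'d \<Rightarrow> 'a::{banach,second_countable_topology}"
  assumes "compact \<Omega>" "f \<in> borel_measurable (lebesgue_on \<Omega>)" "\<And>x. x \<in> \<Omega> \<Longrightarrow> norm (f x) \<le> C"
  shows "integrable (lebesgue_on \<Omega>) f"
proof -
  interpret finite_measure "lebesgue_on \<Omega>"
    using assms(1) by (intro finite_measure_lebesgue_on lmeasurable_compact)
  show ?thesis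
    using assms by (intro integrable_const_bound[where B=C]) auto
qed

lemma integrable_lebesgue_on_continuous:
  fixes f :: "real^'d \<Rightarrow> 'a::euclidean_space"
  assumes "compact \<Omega>" "continuous_on UNIV f"
  shows "integrable (lebesgue_on \<Omega>) f"
proof -
  obtain C where "\<And>x. x \<in> \<Omega> \<Longrightarrow> norm (f x) \<le> C"
    using compact_continuous_image[OF continuous_on_subset[OF assms(2) subset_UNIV] assms(1)]
    by (force dest: compact_imp_bounded simp: bounded_iff)
  then show ?thesis
    using assms by (intro integrable_lebesgue_on_bounded measurable_lebesgue_on
        borel_measurable_continuous_onI)
qed

lemma nearest_measurable_on [measurable]:
  "nearest X w \<in> lebesgue_on \<Omega> \<rightarrow>\<^sub>M count_space UNIV"
  by (intro measurable_lebesgue_on nearest_measurable)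

text \<open>Bridge from the selection \<open>nearest\<close> to the cells: a constant
  \<open>g\<close> yields volumes, the identity first moments, and affine \<open>g i\<close>
  transport costs.\<close>

lemma integral_nearest_split:
  fixes g :: "'n::{finite,linorder} \<Rightarrow> real^'d \<Rightarrow> 'a::euclidean_space"
  assumes \<Omega>: "compact \<Omega>" and X: "X \<in> distinct_seeds" and g: "\<And>i. integrable (lebesgue_on \<Omega>) (g i)"
  shows "(LINT x|lebesgue_on \<Omega>. g (nearest X w x) x) = (\<Sum>i\<in>UNIV. LINT x:Lag \<Omega> X w i|lebesgue. g i x)"
proof -
  have \<Omega>': "\<Omega> \<in> sets lebesgue" using \<Omega> by (simp add: lmeasurable_compact fmeasurableD)
  have L: "Lag \<Omega> X w i \<in> sets (lebesgue_on \<Omega>)" for i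
    using closed_Lag[of \<Omega> X w i] \<Omega> \<Omega>' Lag_subset[of \<Omega> X w i]
    by (auto simp: sets_restrict_space_iff compact_imp_closed)
  have int: "integrable (lebesgue_on \<Omega>) (\<lambda>x. indicator (Lag \<Omega> X w i) x *\<^sub>R g i x)" for i
    using integrable_mult_indicator[OF L g] .
  have eq: "AE x in lebesgue_on \<Omega>. indicator {i} (nearest X w x) *\<^sub>R g i x
      = indicator (Lag \<Omega> X w i) x *\<^sub>R g i x" for i
    using AE_mem_Lag_iff_nearest[OF X \<Omega>', of w i] by eventually_elim (auto simp: indicator_def)
  \<comment> \<open>Selecting by index makes this decomposition exact at every point; replacing
    index indicators by cell indicators, as in \<open>eq\<close>, is valid only almost
    everywhere.\<close>
  have split: "g (nearest X w x) x = (\<Sum>i\<in>UNIV. indicator {i} (nearest X w x) *\<^sub>R g i x)" for x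
  proof -
    have "(\<Sum>i\<in>UNIV. indicator {i} (nearest X w x) *\<^sub>R g i x)
      = (\<Sum>i\<in>UNIV. if nearest X w x = i then g i x else 0)"
      by (intro sum.cong) (auto simp: indicator_def)
    then show ?thesis by simp
  qed
  have meas: "(\<lambda>x. indicator {i} (nearest X w x) *\<^sub>R g i x) \<in> borel_measurable (lebesgue_on \<Omega>)" for i
    using borel_measurable_integrable[OF g[of i]]
    by (intro borel_measurable_scaleR measurable_compose[OF nearest_measurable_on]) auto
  have meas': "(\<lambda>x. indicator (Lag \<Omega> X w i) x *\<^sub>R g i x) \<in> borel_measurable (lebesgue_on \<Omega>)" for i
    using int by (rule borel_measurable_integrable)
  have int': "integrable (lebesgue_on \<Omega>) (\<lambda>x. indicator {i} (nearest X w x) *\<^sub>R g i x)" for i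
    using int integrable_cong_AE[OF meas meas' eq] by blast
  have "(LINT x|lebesgue_on \<Omega>. g (nearest X w x) x)
      = (\<Sum>i\<in>UNIV. LINT x|lebesgue_on \<Omega>. indicator {i} (nearest X w x) *\<^sub>R g i x)"
    unfolding split by (rule Bochner_Integration.integral_sum) (rule int')
  also have "\<dots> = (\<Sum>i\<in>UNIV. LINT x|lebesgue_on \<Omega>. indicator (Lag \<Omega> X w i) x *\<^sub>R g i x)"
    by (intro sum.cong refl integral_cong_AE meas meas' eq)
  also have "\<dots> = (\<Sum>i\<in>UNIV. LINT x:Lag \<Omega> X w i|lebesgue. g i x)"
  proof (intro sum.cong refl)
    fix i
    have "(LINT x|lebesgue_on \<Omega>. indicator (Lag \<Omega> X w i) x *\<^sub>R g i x)
      = (LINT x|lebesgue. indicator \<Omega> x *\<^sub>R (indicator (Lag \<Omega> X w i) x *\<^sub>R g i x))"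
      using \<Omega>' by (simp add: integral_restrict_space)
    also have "\<dots> = (LINT x:Lag \<Omega> X w i|lebesgue. g i x)"
      unfolding set_lebesgue_integral_def using Lag_subset[of \<Omega> X w i]
      by (intro Bochner_Integration.integral_cong) (auto simp: indicator_def)
    finally show "(LINT x|lebesgue_on \<Omega>. indicator (Lag \<Omega> X w i) x *\<^sub>R g i x)
      = (LINT x:Lag \<Omega> X w i|lebesgue. g i x)" .
  qed
  finally show ?thesis .
qed

lemma set_lint_const:
  fixes c :: "'a::euclidean_space"
  assumes "compact S"
  shows "(LINT x:S|lebesgue. c) = vol S *\<^sub>R (c::'a)"
  using assms lmeasurable_compact[of S]
  by (subst set_integral_const) (auto simp: vol_def fmeasurable_def)

lemma compact_Lag: "compact \<Omega> \<Longrightarrow> compact (Lag \<Omega> X w i)"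
  using closed_Lag[of \<Omega> X w i] Lag_subset[of \<Omega> X w i]
  by (metis compact_Int_closed compact_imp_closed inf.absorb2 inf_commute)

lemma lebesgue_on_const:
  assumes "compact \<Omega>"
  shows "integrable (lebesgue_on \<Omega>) (\<lambda>x. c::'a::euclidean_space)"
    "(LINT x|lebesgue_on \<Omega>. c) = vol \<Omega> *\<^sub>R c"
proof -
  show "integrable (lebesgue_on \<Omega>) (\<lambda>x. c)"
    using assms by (intro integrable_lebesgue_on_continuous) auto
  show "(LINT x|lebesgue_on \<Omega>. c) = vol \<Omega> *\<^sub>R c"
    using set_lint_const[OF assms, of c] set_lint_eq[of \<Omega> "\<lambda>x. c"] assms lmeasurable_compact[of \<Omega>]
    by (simp add: fmeasurableD)
qed

section \<open>Existence of weights with prescribed volumes\<close>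

lemma sum_vol_Lag:
  fixes X :: "real^'d^('n::{finite,linorder})"
  assumes "compact \<Omega>" "X \<in> distinct_seeds"
  shows "(\<Sum>i\<in>UNIV. vol (Lag \<Omega> X w i)) = vol \<Omega>"
  using integral_nearest_split[OF assms, of "\<lambda>_ _. 1::real" w] lebesgue_on_const[OF assms(1), of "1::real"]
    set_lint_const[OF compact_Lag[OF assms(1)], of X w _ "1::real"]
  by simp

text \<open>The weights maximise the Kantorovich dual functional. Continuity, invariance under
  constant shifts and coercivity on the slice where the last weight is zero give a maximiser;
  raising one weight there shows that no cell is too small, and the total volume then forces
  equality.\<close>

lemma exists_weights:
  fixes X :: "real^'d^('n::{finite,linorder})"
  assumes \<Omega>: "compact \<Omega>" and X: "X \<in> distinct_seeds" and v: "v \<in> target_volumes \<Omega>"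
  shows "\<exists>w. \<forall>i. vol (Lag \<Omega> X w i) = v $ i"
proof -
  let ?M = "lebesgue_on \<Omega>"
  interpret finite_measure ?M
    using \<Omega> by (intro finite_measure_lebesgue_on lmeasurable_compact)
  note [measurable] = measurable_lebesgue_on[OF power_dist_measurable]
  have v0: "0 < v $ i" for i
    using v by (auto simp: target_volumes_def)
  have sv: "(\<Sum>i\<in>UNIV. v $ i) = vol \<Omega>"
    using v by (auto simp: target_volumes_def)
  have [simp]: "measure ?M \<Omega> = vol \<Omega>"
    using \<Omega> by (simp add: vol_def measure_restrict_space lmeasurable_compact fmeasurableD)
  have vol0: "0 \<le> vol \<Omega>" by (simp add: vol_def)
  \<comment> \<open>The lower envelope of the power distances, that is, the c-transform of the
    weights for the quadratic cost.\<close>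
  define \<phi> where "\<phi> w x = power_dist X w (nearest X w x) x" for w x
  \<comment> \<open>the Kantorovich dual functional, whose \<open>i\<close>-th partial derivative is \<open>v $ i - vol (Lag \<Omega> X w i)\<close>\<close>
  define K where "K w = (LINT x|?M. \<phi> w x) + (\<Sum>i\<in>UNIV. v $ i * w $ i)" for w
  obtain a where a: "\<And>x. x \<in> \<Omega> \<Longrightarrow> norm x \<le> a"
    using compact_imp_bounded[OF \<Omega>] by (auto simp: bounded_iff)
  define C where "C = (\<bar>a\<bar> + norm X)\<^sup>2"
  have C0: "0 \<le> C" by (simp add: C_def)
  have C: "(norm (x - X $ i))\<^sup>2 \<le> C" if "x \<in> \<Omega>" for x i
    unfolding C_def using a[OF that] Finite_Cartesian_Product.norm_nth_le[of X i] norm_triangle_ineq4[of x "X $ i"]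
    by (intro power_mono) auto
  have wn: "\<bar>w $ i\<bar> \<le> norm w" for w :: "real^('n::{finite,linorder})" and i by (rule component_le_norm_cart)
  have \<phi>_le: "\<phi> w x \<le> power_dist X w i x" for w x i
    by (simp add: \<phi>_def nearest_le)
  have \<phi>_int: "integrable ?M (\<phi> w)" for w
  proof (rule integrable_lebesgue_on_bounded[OF \<Omega>])
    show "\<phi> w \<in> borel_measurable ?M"
      unfolding \<phi>_def by (rule measurable_compose_countable[OF _ nearest_measurable_on]) measurable
    show "norm (\<phi> w x) \<le> C + norm w" if "x \<in> \<Omega>" for x
      using C[OF that, of "nearest X w x"] wn[of w "nearest X w x"]
        zero_le_power2[of "norm (x - X $ nearest X w x)"]
      unfolding \<phi>_def power_dist_def real_norm_def by linarith
  qed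
  have \<phi>_lip: "\<phi> w x \<le> \<phi> w' x + norm (w - w')" for w w' x
    using \<phi>_le[of w x "nearest X w' x"] wn[of "w - w'" "nearest X w' x"]
    by (simp add: \<phi>_def power_dist_def)
  have I_lip: "(LINT x|?M. \<phi> w x) \<le> (LINT x|?M. \<phi> w' x) + vol \<Omega> * norm (w - w')" for w w'
  proof -
    have "(LINT x|?M. \<phi> w x) \<le> (LINT x|?M. \<phi> w' x + norm (w - w'))"
      by (intro integral_mono \<phi>_int Bochner_Integration.integrable_add lebesgue_on_const[OF \<Omega>] \<phi>_lip)
    then show ?thesis
      using lebesgue_on_const[OF \<Omega>, of "norm (w - w')"] by (simp add: \<phi>_int)
  qed
  have "(vol \<Omega>)-lipschitz_on UNIV (\<lambda>w. LINT x|?M. \<phi> w x)"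
  proof (rule lipschitz_onI[OF _ vol0])
    fix w w'
    show "dist (LINT x|?M. \<phi> w x) (LINT x|?M. \<phi> w' x) \<le> vol \<Omega> * dist w w'"
      using I_lip[of w w'] I_lip[of w' w] by (simp add: dist_norm norm_minus_commute)
  qed
  then have contK: "continuous_on S K" for S
    unfolding K_def
    by (intro continuous_intros lipschitz_on_continuous_on[OF lipschitz_on_subset[OF _ subset_UNIV]])
  \<comment> \<open>The shift lowers \<open>\<phi>\<close> by \<open>c\<close> everywhere on
    \<open>\<Omega>\<close>; since the masses \<open>v $ i\<close> sum to
    \<open>vol \<Omega>\<close>, the linear term of \<open>K\<close> makes up the loss.\<close>
  have shift: "K (w + (\<chi> i. c)) = K w" for w c
  proof -
    have p: "power_dist X (w + (\<chi> i. c)) i x = power_dist X w i x - c" for i x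
      by (simp add: power_dist_def)
    have "\<phi> (w + (\<chi> i. c)) x = \<phi> w x - c" for x
      by (simp add: \<phi>_def nearest_def p)
    then have "(LINT x|?M. \<phi> (w + (\<chi> i. c)) x) = (LINT x|?M. \<phi> w x) - vol \<Omega> * c"
      using lebesgue_on_const[OF \<Omega>, of c] by (simp add: \<phi>_int)
    then show ?thesis
      by (simp add: K_def algebra_simps sum.distrib sum_distrib_left[symmetric] sv)
  qed
  let ?l = "Max UNIV :: 'n"
  \<comment> \<open>The largest weight exceeds \<open>w $ i\<close> by at most
    \<open>vol \<Omega> * C / v $ i\<close>. With the last weight zero, this bounds each component
    by the corresponding summand, and \<open>r\<close> bounds the l1 norm.\<close>
  define r where "r = (\<Sum>i\<in>UNIV. vol \<Omega> * C / v $ ?l + vol \<Omega> * C / v $ i)"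
  have coercive: "norm w \<le> r" if w: "w $ ?l = 0" "K 0 \<le> K w" for w
  proof -
    obtain p where p: "\<And>i. w $ i \<le> w $ p"
      using ex_is_arg_min_if_finite[OF finite_class.finite_UNIV UNIV_not_empty, of "\<lambda>i. - w $ i"]
      by (auto simp: is_arg_min_linorder)
    \<comment> \<open>Testing the envelope against the seed of largest weight makes
      \<open>K w\<close> small when the weights spread far apart.\<close>
    have "(LINT x|?M. \<phi> w x) \<le> (LINT x|?M. C - w $ p)"
    proof (intro integral_mono \<phi>_int lebesgue_on_const[OF \<Omega>])
      fix x assume "x \<in> space ?M"
      then show "\<phi> w x \<le> C - w $ p"
        using C[of x p] \<phi>_le[of w x p] by (auto simp: power_dist_def)
    qed
    also have "\<dots> = vol \<Omega> * (C - w $ p)" using lebesgue_on_const(2)[OF \<Omega>, of "C - w $ p"] by simp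
    finally have "K w \<le> vol \<Omega> * C - (\<Sum>i\<in>UNIV. v $ i * (w $ p - w $ i))"
      by (simp add: K_def algebra_simps sum_subtractf sum_distrib_right[symmetric] sv)
    \<comment> \<open>At zero weights \<open>\<phi>\<close> is a squared distance.\<close>
    moreover have "0 \<le> K 0"
      by (auto simp: K_def \<phi>_def power_dist_def)
    ultimately have s: "(\<Sum>i\<in>UNIV. v $ i * (w $ p - w $ i)) \<le> vol \<Omega> * C"
      using w by linarith
    have e: "w $ p - w $ i \<le> vol \<Omega> * C / v $ i" for i
    proof -
      have "v $ i * (w $ p - w $ i) \<le> (\<Sum>i\<in>UNIV. v $ i * (w $ p - w $ i))"
        using p v0 by (intro member_le_sum) (auto simp: less_imp_le)
      with s show ?thesis using v0[of i] by (simp add: field_simps)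
    qed
    have q: "0 \<le> vol \<Omega> * C / v $ i" for i
      using vol0 C0 v0[of i] by simp
    have "\<bar>w $ i\<bar> \<le> vol \<Omega> * C / v $ ?l + vol \<Omega> * C / v $ i" for i
      using e[of i] e[of ?l] p[of i] p[of ?l] q[of i] q[of ?l] w(1) by linarith
    then have "(\<Sum>i\<in>UNIV. \<bar>w $ i\<bar>) \<le> r"
      unfolding r_def by (intro sum_mono)
    then show ?thesis using norm_le_l1_cart[of w] by linarith
  qed
  have r0: "norm (0::real^('n::{finite,linorder})) \<le> r" by (rule coercive) auto
  with r0 have "cball (0::real^('n::{finite,linorder})) r \<noteq> {}" by auto
  then obtain w where "w \<in> cball 0 r" and max0: "\<And>u. u \<in> cball 0 r \<Longrightarrow> K u \<le> K w"
    using continuous_attains_sup[OF compact_cball _ contK] by blast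
  \<comment> \<open>Shift \<open>u\<close> into the slice: the shifted vector either lies in the
    ball by coercivity or has a value below \<open>K 0\<close>, and \<open>0\<close> is in the
    ball.\<close>
  have max: "K u \<le> K w" for u
  proof -
    define u' where "u' = u + (\<chi> i. - u $ ?l)"
    have "u' $ ?l = 0" by (simp add: u'_def)
    then have "K u' \<le> K w"
      using coercive[of u'] max0[of u'] max0[of 0] r0 by (cases "K 0 \<le> K u'") auto
    then show ?thesis using shift[of u] by (simp add: u'_def)
  qed
  have Lm: "Lag \<Omega> X u i \<in> sets ?M" for u i
    using closed_Lag[of \<Omega> X u i] \<Omega> Lag_subset[of \<Omega> X u i]
    by (auto simp: sets_restrict_space_iff compact_imp_closed lmeasurable_compact fmeasurableD)
  have volM: "vol (Lag \<Omega> X u i) = measure ?M (Lag \<Omega> X u i)" for u i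
    using Lag_subset[of \<Omega> X u i] \<Omega>
    by (simp add: vol_def measure_restrict_space lmeasurable_compact fmeasurableD)
  \<comment> \<open>Raising weight \<open>i\<close> by \<open>e\<close> lowers \<open>\<phi>\<close>
    by at most \<open>e\<close>, and only on the enlarged cell. Thus \<open>K\<close> grows by at
    least \<open>e\<close> times \<open>v $ i\<close> minus the enlarged volume, which maximality
    forbids to be positive.\<close>
  have up: "v $ i \<le> vol (Lag \<Omega> X (w + e *\<^sub>R axis i 1) i)" if "e > 0" for e i
  proof -
    define u where "u = w + e *\<^sub>R axis i 1"
    have pu: "power_dist X u j x = power_dist X w j x - (if j = i then e else 0)" for j x
      by (auto simp: u_def power_dist_def axis_def)
    have "\<phi> w x - e * indicator (Lag \<Omega> X u i) x \<le> \<phi> u x" if "x \<in> \<Omega>" for x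
    proof (cases "nearest X u x = i")
      case True
      then have "x \<in> Lag \<Omega> X u i" using mem_Lag_nearest[OF that, of X u] by simp
      then show ?thesis using True \<phi>_le[of w x i] by (simp add: \<phi>_def[of u] pu)
    next
      case False
      then show ?thesis using \<phi>_le[of w x "nearest X u x"] \<open>e > 0\<close>
        by (simp add: \<phi>_def[of u] pu indicator_def)
    qed
    then have "(LINT x|?M. \<phi> w x - e * indicator (Lag \<Omega> X u i) x) \<le> (LINT x|?M. \<phi> u x)"
      by (intro integral_mono \<phi>_int Bochner_Integration.integrable_diff integrable_mult_right
          integrable_real_indicator Lm) (auto simp: emeasure_eq_measure)
    also have "(LINT x|?M. \<phi> w x - e * indicator (Lag \<Omega> X u i) x)
        = (LINT x|?M. \<phi> w x) - e * vol (Lag \<Omega> X u i)"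
      using Lag_subset[of \<Omega> X u i]
      by (subst Bochner_Integration.integral_diff)
        (auto simp: \<phi>_int volM Lm Int_absorb2 emeasure_eq_measure intro!: integrable_real_indicator)
    finally have 1: "(LINT x|?M. \<phi> w x) - e * vol (Lag \<Omega> X u i) \<le> (LINT x|?M. \<phi> u x)" .
    have "(\<Sum>j\<in>UNIV. v $ j * u $ j) = (\<Sum>j\<in>UNIV. v $ j * w $ j + (if j = i then e * v $ i else 0))"
      by (intro sum.cong) (auto simp: u_def axis_def algebra_simps)
    then have "(\<Sum>j\<in>UNIV. v $ j * u $ j) = (\<Sum>j\<in>UNIV. v $ j * w $ j) + e * v $ i"
      by (simp add: sum.distrib)
    then have "e * v $ i \<le> e * vol (Lag \<Omega> X u i)"
      using 1 max[of u] by (simp add: K_def)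
    then show ?thesis using \<open>e > 0\<close> by (simp add: u_def)
  qed
  have ge: "v $ i \<le> vol (Lag \<Omega> X w i)" for i
  proof -
    \<comment> \<open>The enlarged cells decrease to the cell of \<open>w\<close> as the increment
      tends to zero, so the bound \<open>up\<close> passes to the limit by continuity of measure
      from above.\<close>
    define A where "A n = Lag \<Omega> X (w + inverse (real (Suc n)) *\<^sub>R axis i 1) i" for n
    have memA: "x \<in> A n \<longleftrightarrow> x \<in> \<Omega> \<and>
      (\<forall>j. j \<noteq> i \<longrightarrow> power_dist X w i x - inverse (real (Suc n)) \<le> power_dist X w j x)" for x n
      unfolding A_def mem_Lag_iff power_dist_def by (auto simp: axis_def algebra_simps)
    have "decseq A"
    proof (rule decseq_SucI)
      show "A (Suc n) \<subseteq> A n" for n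
      proof
        have "inverse (real (Suc (Suc n))) \<le> inverse (real (Suc n))" by (simp add: field_simps)
        then show "x \<in> A n" if "x \<in> A (Suc n)" for x using that unfolding memA by (meson diff_left_mono order_trans)
      qed
    qed
    moreover have "(\<Inter>n. A n) = Lag \<Omega> X w i"
    proof (intro set_eqI iffI)
      fix x assume x: "x \<in> (\<Inter>n. A n)"
      have "power_dist X w i x \<le> power_dist X w j x" for j
      proof (cases "j = i")
        case False
        have "(\<lambda>n. power_dist X w i x - inverse (real (Suc n))) \<longlonglongrightarrow> power_dist X w i x - 0"
          by (intro tendsto_diff tendsto_const LIMSEQ_inverse_real_of_nat)
        then show ?thesis
          using x False unfolding INT_iff memA by (intro LIMSEQ_le_const2) auto
      qed simp
      then show "x \<in> Lag \<Omega> X w i" using x memA by (auto simp: mem_Lag_iff)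
    next
      fix x assume x: "x \<in> Lag \<Omega> X w i"
      have "power_dist X w i x - inverse (real (Suc n)) \<le> power_dist X w i x" for n by simp
      then show "x \<in> (\<Inter>n. A n)" using x unfolding INT_iff memA mem_Lag_iff by (meson order_trans)
    qed
    ultimately have "(\<lambda>n. measure ?M (A n)) \<longlonglongrightarrow> measure ?M (Lag \<Omega> X w i)"
      using finite_Lim_measure_decseq[of A] Lm by (auto simp: A_def)
    moreover have "v $ i \<le> measure ?M (A n)" for n
      using up[of "inverse (real (Suc n))" i] by (simp add: A_def volM)
    ultimately show ?thesis
      unfolding volM by (intro LIMSEQ_le_const) auto
  qed
  \<comment> \<open>The excess volumes are nonnegative by \<open>ge\<close>, so a zero total makes
    each of them vanish.\<close>
  have "(\<Sum>i\<in>UNIV. vol (Lag \<Omega> X w i) - v $ i) = 0"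
    by (simp add: sum_subtractf sum_vol_Lag[OF \<Omega> X] sv)
  then have "\<forall>i. vol (Lag \<Omega> X w i) - v $ i = 0"
    using ge by (subst (asm) sum_nonneg_eq_0_iff) auto
  then show ?thesis by auto
qed

text \<open>The choice in \<open>opt_weights\<close> has a witness: subtracting the last weight from
  all components changes no cell.\<close>

lemma vol_Lag_opt_weights:
  fixes X :: "real^'d^('n::{finite,linorder})"
  assumes "compact \<Omega>" "X \<in> distinct_seeds" "v \<in> target_volumes \<Omega>"
  shows "vol (Lag \<Omega> X (opt_weights \<Omega> X v) i) = v $ i"
proof -
  obtain w where w: "\<And>i. vol (Lag \<Omega> X w i) = v $ i"
    using exists_weights[OF assms] by blast
  let ?w = "\<chi> i. w $ i - w $ Max UNIV"
  have "Lag \<Omega> X ?w i = Lag \<Omega> X w i" for i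
    by (auto simp: Lag_def)
  then have "?w $ Max UNIV = 0 \<and> (\<forall>i. vol (Lag \<Omega> X ?w i) = v $ i)"
    using w by simp
  then show ?thesis
    unfolding opt_weights_def by (rule someI2) blast
qed

section \<open>Transport maps and Kantorovich duality\<close>

text \<open>The cells come from \<open>X\<close>, while the targets \<open>Y\<close> are arbitrary
  and may coincide. Masses are therefore matched on indices first, and indices are sent to points
  afterwards. This supplies the competitors for bounding \<open>H\<close>.\<close>

lemma nearest_transport_map:
  fixes X :: "real^'d^('n::{finite,linorder})"
  assumes \<Omega>: "compact \<Omega>" and X: "X \<in> distinct_seeds"
    and w: "\<And>i. vol (Lag \<Omega> X w i) = v $ i"
  shows "(\<lambda>x. Y $ nearest X w x) \<in> transport_maps \<Omega> Y v"
proof -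
  let ?M = "lebesgue_on \<Omega>"
  interpret finite_measure ?M
    using \<Omega> by (intro finite_measure_lebesgue_on lmeasurable_compact)
  have \<Omega>': "\<Omega> \<in> sets lebesgue" using \<Omega> by (simp add: lmeasurable_compact fmeasurableD)
  \<comment> \<open>The index space is finite, so singletons suffice; the preimage of
    \<open>i\<close> is cell \<open>i\<close> up to a null set.\<close>
  have "distr ?M (count_space UNIV) (nearest X w) = point_measure UNIV (\<lambda>i. ennreal (v $ i))"
  proof (rule measure_eqI_finite)
    fix i :: 'n
    have L: "Lag \<Omega> X w i \<in> sets ?M"
      using closed_Lag[of \<Omega> X w i] \<Omega> \<Omega>' Lag_subset[of \<Omega> X w i]
      by (auto simp: sets_restrict_space_iff compact_imp_closed)
    have "emeasure (distr ?M (count_space UNIV) (nearest X w)) {i} = emeasure ?M (nearest X w -` {i} \<inter> space ?M)"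
      by (subst emeasure_distr) auto
    also have "\<dots> = emeasure ?M (Lag \<Omega> X w i)"
      using AE_mem_Lag_iff_nearest[OF X \<Omega>', of w i]
      by (intro emeasure_eq_AE L measurable_sets[OF nearest_measurable_on]) (auto elim: AE_mp)
    also have "\<dots> = ennreal (v $ i)"
      using Lag_subset[of \<Omega> X w i] w[of i] \<Omega>'
      by (simp add: emeasure_eq_measure vol_def measure_restrict_space)
    finally show "emeasure (distr ?M (count_space UNIV) (nearest X w)) {i} =
      emeasure (point_measure UNIV (\<lambda>i. ennreal (v $ i))) {i}"
      by (simp add: emeasure_point_measure_finite)
  qed (auto simp: sets_point_measure)
  then have "discrete_target Y v = distr ?M borel (\<lambda>x. Y $ nearest X w x)"
    unfolding discrete_target_def
    by (subst distr_distr[symmetric, where N="count_space UNIV" and g="\<lambda>i. Y $ i", unfolded comp_def]) auto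
  moreover have "(\<lambda>x. Y $ nearest X w x) \<in> borel_measurable ?M"
    by (rule measurable_compose[OF nearest_measurable_on]) simp
  ultimately show ?thesis by (auto simp: transport_maps_def)
qed

text \<open>A real infimum lies below its members once the set is bounded below; costs are
  nonnegative, so \<open>0\<close> serves.\<close>

lemma W2_squared_le:
  assumes "S \<in> transport_maps \<Omega> X v"
  shows "W2_squared \<Omega> X v \<le> (LINT x:\<Omega>|lebesgue. (norm (x - S x))\<^sup>2)"
  unfolding W2_squared_def using assms
  by (intro cINF_lower bdd_belowI2[where m=0])
    (auto simp: set_lebesgue_integral_def intro!: integral_nonneg_AE)

text \<open>On the bounded set \<open>\<Omega>\<close> the map takes only seed values, so the cost
  is bounded and such integrals may be compared and split.\<close>

lemma transport_cost_integrable: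
  fixes Y :: "real^'d^('n::{finite,linorder})"
  assumes \<Omega>: "compact \<Omega>" and S: "S \<in> transport_maps \<Omega> Y v"
  shows "integrable (lebesgue_on \<Omega>) (\<lambda>x. (norm (x - S x))\<^sup>2)"
proof -
  obtain a where a: "\<And>x. x \<in> \<Omega> \<Longrightarrow> norm x \<le> a"
    using compact_imp_bounded[OF \<Omega>] by (auto simp: bounded_iff)
  have Sm: "S \<in> borel_measurable (lebesgue_on \<Omega>)" and r: "\<And>x. x \<in> \<Omega> \<Longrightarrow> S x \<in> range (\<lambda>i. Y $ i)"
    using S by (auto simp: transport_maps_def)
  have "(\<lambda>x. x) \<in> borel_measurable (lebesgue_on \<Omega>)" by (intro measurable_lebesgue_on) simp
  note [measurable] = this Sm
  show ?thesis
  proof (rule integrable_lebesgue_on_bounded[OF \<Omega>])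
    show "(\<lambda>x. (norm (x - S x))\<^sup>2) \<in> borel_measurable (lebesgue_on \<Omega>)" by measurable
    show "norm ((norm (x - S x))\<^sup>2) \<le> (\<bar>a\<bar> + norm Y)\<^sup>2" if x: "x \<in> \<Omega>" for x
    proof -
      obtain i where "S x = Y $ i" using r[OF x] by auto
      then have "norm (x - S x) \<le> \<bar>a\<bar> + norm Y"
        using a[OF x] Finite_Cartesian_Product.norm_nth_le[of Y i] norm_triangle_ineq4[of x "S x"] by simp
      then show ?thesis by (simp add: power_mono)
    qed
  qed
qed

text \<open>Kantorovich duality: the weights have the same integral under every transport map.\<close>

lemma W2_squared_eq:
  fixes X :: "real^'d^('n::{finite,linorder})"
  assumes \<Omega>: "compact \<Omega>" and X: "X \<in> distinct_seeds"
    and w: "\<And>i. vol (Lag \<Omega> X w i) = v $ i"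
  shows "W2_squared \<Omega> X v = (LINT x:\<Omega>|lebesgue. (norm (x - X $ nearest X w x))\<^sup>2)"
proof (rule antisym)
  let ?M = "lebesgue_on \<Omega>" and ?S = "\<lambda>x. X $ nearest X w x"
  interpret finite_measure ?M
    using \<Omega> by (intro finite_measure_lebesgue_on lmeasurable_compact)
  have \<Omega>': "\<Omega> \<in> sets lebesgue" using \<Omega> by (simp add: lmeasurable_compact fmeasurableD)
  have S: "?S \<in> transport_maps \<Omega> X v" by (rule nearest_transport_map[OF assms])
  show "W2_squared \<Omega> X v \<le> (LINT x:\<Omega>|lebesgue. (norm (x - ?S x))\<^sup>2)"
    by (rule W2_squared_le[OF S])
  \<comment> \<open>Distinctness of the seeds lets the weights be read as a Borel function of
    position, which can be integrated against \<open>discrete_target\<close>.\<close>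
  define \<omega> where "\<omega> y = (\<Sum>i\<in>UNIV. w $ i * indicator {X $ i} y)" for y
  have \<omega>: "\<omega> (X $ i) = w $ i" for i
  proof -
    have "\<omega> (X $ i) = (\<Sum>j\<in>UNIV. if j = i then w $ j else 0)"
      unfolding \<omega>_def using X
      by (intro sum.cong) (auto simp: indicator_def distinct_seeds_def)
    then show ?thesis by simp
  qed
  have [measurable]: "\<omega> \<in> borel_measurable borel" unfolding \<omega>_def by measurable
  have \<omega>_int: "integrable ?M (\<lambda>x. \<omega> (Q x))"
    and \<omega>_val: "(LINT x|?M. \<omega> (Q x)) = (LINT y|discrete_target X v. \<omega> y)"
    if Q: "Q \<in> transport_maps \<Omega> X v" for Q
  proof -
    have [measurable]: "Q \<in> borel_measurable ?M" and d: "distr ?M borel Q = discrete_target X v"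
      and r: "\<And>x. x \<in> \<Omega> \<Longrightarrow> Q x \<in> range (\<lambda>i. X $ i)"
      using Q by (auto simp: transport_maps_def)
    show "(LINT x|?M. \<omega> (Q x)) = (LINT y|discrete_target X v. \<omega> y)"
      unfolding d[symmetric] by (subst integral_distr) auto
    show "integrable ?M (\<lambda>x. \<omega> (Q x))"
    proof (rule integrable_lebesgue_on_bounded[OF \<Omega>])
      show "(\<lambda>x. \<omega> (Q x)) \<in> borel_measurable ?M" by measurable
      show "norm (\<omega> (Q x)) \<le> norm w" if "x \<in> \<Omega>" for x
        using r[OF that] component_le_norm_cart[of w] by (auto simp: \<omega>)
    qed
  qed
  show "(LINT x:\<Omega>|lebesgue. (norm (x - ?S x))\<^sup>2) \<le> W2_squared \<Omega> X v"
    unfolding W2_squared_def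
  proof (rule cINF_greatest)
    fix Q assume Q: "Q \<in> transport_maps \<Omega> X v"
    \<comment> \<open>Pointwise optimality for the cost reduced by the weights; after integration
      the weight terms on the two sides are equal and cancel.\<close>
    have le: "(norm (x - ?S x))\<^sup>2 - \<omega> (?S x) \<le> (norm (x - Q x))\<^sup>2 - \<omega> (Q x)" if x: "x \<in> \<Omega>" for x
    proof -
      obtain i where i: "Q x = X $ i" using Q x by (auto simp: transport_maps_def)
      show ?thesis using nearest_le[of X w x i] by (simp add: i \<omega> power_dist_def)
    qed
    have "(LINT x|?M. (norm (x - ?S x))\<^sup>2 - \<omega> (?S x)) \<le> (LINT x|?M. (norm (x - Q x))\<^sup>2 - \<omega> (Q x))"
      using le by (intro integral_mono Bochner_Integration.integrable_diff \<omega>_int Q S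
          transport_cost_integrable[OF \<Omega> S] transport_cost_integrable[OF \<Omega> Q]) auto
    then have "(LINT x|?M. (norm (x - ?S x))\<^sup>2) \<le> (LINT x|?M. (norm (x - Q x))\<^sup>2)"
      by (simp add: \<omega>_int[OF Q] \<omega>_int[OF S] \<omega>_val[OF Q] \<omega>_val[OF S]
          transport_cost_integrable[OF \<Omega> S] transport_cost_integrable[OF \<Omega> Q])
    then show "(LINT x:\<Omega>|lebesgue. (norm (x - ?S x))\<^sup>2) \<le> (LINT x:\<Omega>|lebesgue. (norm (x - Q x))\<^sup>2)"
      by (simp add: set_lint_eq[OF \<Omega>'])
  qed (use S in blast)
qed

section \<open>The centroid gap as a supergradient of \<open>H\<close>\<close>

text \<open>The vector \<open>P(X)\<close> of the opening comment, whose squared norm is the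
  objective.\<close>

definition centroid_gap ::
  "(real^'d) set \<Rightarrow> real^('n::{finite,linorder}) \<Rightarrow> real^'d^('n::{finite,linorder}) \<Rightarrow>
   real^'d^('n::{finite,linorder}) \<Rightarrow> real^'d^('n::{finite,linorder})" where
  "centroid_gap \<Omega> v b X = (\<chi> i. v $ i *\<^sub>R (b $ i - cell_centroid \<Omega> X v i))"

lemma inner_centroid_gap:
  "centroid_gap \<Omega> v b X \<bullet> Y =
     (\<Sum>i\<in>UNIV. v $ i * (Y $ i \<bullet> b $ i)) - (\<Sum>i\<in>UNIV. Y $ i \<bullet> (v $ i *\<^sub>R cell_centroid \<Omega> X v i))"
  unfolding inner_vec_def[of "centroid_gap \<Omega> v b X"]
  by (simp add: centroid_gap_def algebra_simps inner_commute sum_subtractf)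

text \<open>The cell has volume \<open>v $ i\<close>, so the normalising factor of the centroid
  cancels and the first moment remains.\<close>

lemma scaled_cell_centroid:
  assumes "compact \<Omega>" "X \<in> distinct_seeds" "v \<in> target_volumes \<Omega>"
  shows "v $ i *\<^sub>R cell_centroid \<Omega> X v i = (LINT x:Lag \<Omega> X (opt_weights \<Omega> X v) i|lebesgue. x)"
proof -
  have "v $ i \<noteq> 0" using assms(3) by (auto simp: target_volumes_def less_imp_neq[symmetric] dest: spec[of _ i])
  then show ?thesis
    by (simp add: cell_centroid_def centroid_def opt_cell_def vol_Lag_opt_weights[OF assms])
qed

text \<open>With the cells of \<open>X\<close> fixed, the cost of sending them to \<open>Y\<close>
  sees each cell only through its volume and first moment.\<close>

lemma nearest_cost:
  fixes X Y :: "real^'d^('n::{finite,linorder})"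
  assumes \<Omega>: "compact \<Omega>" and X: "X \<in> distinct_seeds" and v: "v \<in> target_volumes \<Omega>"
  defines "w \<equiv> opt_weights \<Omega> X v"
  shows "(LINT x:\<Omega>|lebesgue. (norm (x - Y $ nearest X w x))\<^sup>2) =
    (LINT x:\<Omega>|lebesgue. (norm x)\<^sup>2)
    - 2 * (\<Sum>i\<in>UNIV. Y $ i \<bullet> (v $ i *\<^sub>R cell_centroid \<Omega> X v i)) + (\<Sum>i\<in>UNIV. v $ i * (norm (Y $ i))\<^sup>2)"
proof -
  let ?M = "lebesgue_on \<Omega>"
  have \<Omega>': "\<Omega> \<in> sets lebesgue" using \<Omega> by (simp add: lmeasurable_compact fmeasurableD)
  \<comment> \<open>This is the cost to \<open>Y $ i\<close> minus the squared norm of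
    \<open>x\<close>, hence affine in \<open>x\<close> on each cell.\<close>
  let ?g = "\<lambda>i x. (norm (Y $ i))\<^sup>2 - 2 * (Y $ i \<bullet> x)"
  have gi: "integrable ?M (?g i)" for i
    by (intro integrable_lebesgue_on_continuous[OF \<Omega>] continuous_intros)
  have ni: "integrable ?M (\<lambda>x. (norm x)\<^sup>2)"
    by (intro integrable_lebesgue_on_continuous[OF \<Omega>] continuous_intros)
  have ci: "integrable ?M (\<lambda>x. (norm (x - Y $ nearest X w x))\<^sup>2)"
    using nearest_transport_map[OF \<Omega> X, of w v Y] vol_Lag_opt_weights[OF \<Omega> X v]
    by (intro transport_cost_integrable[OF \<Omega>]) (auto simp: w_def)
  have e: "?g (nearest X w x) x = (norm (x - Y $ nearest X w x))\<^sup>2 - (norm x)\<^sup>2" for x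
    by (simp add: power2_norm_eq_inner inner_diff_left inner_diff_right inner_commute)
  have L: "(LINT x:Lag \<Omega> X w i|lebesgue. ?g i x) =
      v $ i * (norm (Y $ i))\<^sup>2 - 2 * (Y $ i \<bullet> (v $ i *\<^sub>R cell_centroid \<Omega> X v i))" for i
  proof -
    note cL = compact_Lag[OF \<Omega>, of X w i]
    have Ls: "Lag \<Omega> X w i \<in> sets lebesgue" using cL by (simp add: lmeasurable_compact fmeasurableD)
    have xi: "integrable (lebesgue_on (Lag \<Omega> X w i)) (\<lambda>x. x)"
      by (intro integrable_lebesgue_on_continuous[OF cL] continuous_intros)
    show ?thesis
      unfolding scaled_cell_centroid[OF \<Omega> X v] w_def[symmetric] set_lint_eq[OF Ls]
      using vol_Lag_opt_weights[OF \<Omega> X v, of i] lebesgue_on_const[OF cL, of "(norm (Y $ i))\<^sup>2"] xi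
      by (simp add: w_def)
  qed
  have "(LINT x|?M. ?g (nearest X w x) x) = (\<Sum>i\<in>UNIV. LINT x:Lag \<Omega> X w i|lebesgue. ?g i x)"
    by (rule integral_nearest_split[OF \<Omega> X gi])
  then have "(LINT x|?M. (norm (x - Y $ nearest X w x))\<^sup>2) - (LINT x|?M. (norm x)\<^sup>2) =
     (\<Sum>i\<in>UNIV. v $ i * (norm (Y $ i))\<^sup>2) - 2 * (\<Sum>i\<in>UNIV. Y $ i \<bullet> (v $ i *\<^sub>R cell_centroid \<Omega> X v i))"
    unfolding L e by (simp add: ci ni sum_subtractf sum_distrib_left)
  then show ?thesis by (simp add: set_lint_eq[OF \<Omega>'])
qed

text \<open>The quadratic terms in the cost of the competitor are those that \<open>H_fun\<close>
  subtracts, so the resulting bound is linear in \<open>Y\<close>.\<close>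

lemma H_fun_le_gap:
  fixes X Y :: "real^'d^('n::{finite,linorder})"
  assumes \<Omega>: "compact \<Omega>" and X: "X \<in> distinct_seeds" and v: "v \<in> target_volumes \<Omega>"
  shows "H_fun \<Omega> (v, b) Y \<le> centroid_gap \<Omega> v b X \<bullet> Y"
proof -
  have "W2_squared \<Omega> Y v \<le> (LINT x:\<Omega>|lebesgue. (norm (x - Y $ nearest X (opt_weights \<Omega> X v) x))\<^sup>2)"
    by (intro W2_squared_le nearest_transport_map assms vol_Lag_opt_weights)
  then show ?thesis
    unfolding nearest_cost[OF assms] inner_centroid_gap by (simp add: H_fun_def)
qed

text \<open>For \<open>Y = X\<close> the competitor is optimal by \<open>W2_squared_eq\<close>, so
  the linear bound is attained.\<close>

lemma H_fun_eq_gap: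
  fixes X :: "real^'d^('n::{finite,linorder})"
  assumes \<Omega>: "compact \<Omega>" and X: "X \<in> distinct_seeds" and v: "v \<in> target_volumes \<Omega>"
  shows "H_fun \<Omega> (v, b) X = centroid_gap \<Omega> v b X \<bullet> X"
proof -
  have "W2_squared \<Omega> X v = (LINT x:\<Omega>|lebesgue. (norm (x - X $ nearest X (opt_weights \<Omega> X v) x))\<^sup>2)"
    by (intro W2_squared_eq assms vol_Lag_opt_weights)
  then show ?thesis
    unfolding nearest_cost[OF assms] inner_centroid_gap by (simp add: H_fun_def add_divide_distrib diff_divide_distrib)
qed

text \<open>The first moments of the cells add up to that of \<open>\<Omega>\<close>, and so do the
  vectors \<open>v $ i *\<^sub>R b $ i\<close> by compatibility; the components of the gap thus sum
  to zero.\<close>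

lemma centroid_gap_orthogonal_translations:
  fixes X :: "real^'d^('n::{finite,linorder})"
  assumes \<Omega>: "compact \<Omega>" and X: "X \<in> distinct_seeds" and vb: "(v, b) \<in> compatible_data \<Omega>"
  shows "centroid_gap \<Omega> v b X \<bullet> (\<chi> i. t) = 0"
proof -
  have v: "v \<in> target_volumes \<Omega>" and b: "(\<Sum>i\<in>UNIV. v $ i *\<^sub>R b $ i) = vol \<Omega> *\<^sub>R centroid \<Omega>"
    using vb by (auto simp: compatible_data_def)
  have \<Omega>': "\<Omega> \<in> sets lebesgue" using \<Omega> by (simp add: lmeasurable_compact fmeasurableD)
  have "0 < (\<Sum>i\<in>UNIV. v $ i)"
    using v by (intro sum_pos) (auto simp: target_volumes_def)
  then have "vol \<Omega> \<noteq> 0" using v by (simp add: target_volumes_def)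
  then have "vol \<Omega> *\<^sub>R centroid \<Omega> = (LINT x|lebesgue_on \<Omega>. x)"
    by (simp add: centroid_def set_lint_eq[OF \<Omega>'])
  also have "\<dots> = (\<Sum>i\<in>UNIV. v $ i *\<^sub>R cell_centroid \<Omega> X v i)"
    unfolding scaled_cell_centroid[OF \<Omega> X v]
    by (rule integral_nearest_split[OF \<Omega> X, of "\<lambda>i x. x"])
      (intro integrable_lebesgue_on_continuous[OF \<Omega>] continuous_intros)
  finally show ?thesis
    using b unfolding inner_vec_def[of "centroid_gap \<Omega> v b X"]
    by (simp add: centroid_gap_def scaleR_diff_right sum_subtractf
        inner_sum_left[symmetric] del: inner_scaleR_left)
qed

lemma norm_centroid_gap:
  "(norm (centroid_gap \<Omega> v b X))\<^sup>2 =
     (\<Sum>i\<in>UNIV. (v $ i)\<^sup>2 * (norm (cell_centroid \<Omega> X v i - b $ i))\<^sup>2)"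
  unfolding norm_vec_def[of "centroid_gap \<Omega> v b X"] L2_set_def
  by (simp add: centroid_gap_def norm_minus_commute power_mult_distrib sum_nonneg)

section \<open>First-order optimality and the minimising property\<close>

text \<open>At a point of differentiability a supergradient represents the derivative, and at a
  maximiser over a convex set the derivative towards any point of the set is at most zero.\<close>

lemma inner_le_of_maximal_supergradient:
  fixes h :: "'a::real_inner \<Rightarrow> real"
  assumes h: "h differentiable (at x)" and sup: "\<And>y. h y \<le> h x + p \<bullet> (y - x)"
    and S: "convex S" "x \<in> S" "z \<in> S" and max: "\<And>y. y \<in> S \<Longrightarrow> h y \<le> h x"
  shows "p \<bullet> (z - x) \<le> 0"
proof -
  obtain D where D: "(h has_derivative D) (at x)" using h by (auto simp: differentiable_def)
  \<comment> \<open>By \<open>sup\<close> this difference is maximal at \<open>x\<close>, so its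
    derivative vanishes and \<open>D\<close> is the inner product with \<open>p\<close>.\<close>
  have "((\<lambda>y. h y - p \<bullet> y) has_derivative (\<lambda>u. D u - p \<bullet> u)) (at x)"
    by (intro derivative_intros D)
  then have "(\<lambda>u. D u - p \<bullet> u) = (\<lambda>u. 0)"
  proof (rule has_derivative_local_max)
    show "\<forall>\<^sub>F y in at x. h y - p \<bullet> y \<le> h x - p \<bullet> x"
      using sup by (intro always_eventually) (auto simp: inner_diff_right algebra_simps)
  qed
  then have "D (z - x) = p \<bullet> (z - x)" by (metis eq_iff_diff_eq_0)
  moreover have "D (z - x) \<le> 0"
  proof -
    have "((\<lambda>s. h (x + s *\<^sub>R (z - x))) has_derivative (\<lambda>s. D (s *\<^sub>R (z - x)))) (at 0)"
      by (rule has_derivative_compose[where f="\<lambda>s. x + s *\<^sub>R (z - x)" and g=h])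
        (auto intro!: derivative_eq_intros simp: D)
    moreover have "D (s *\<^sub>R (z - x)) = D (z - x) * s" for s
      using linear_scale[OF has_derivative_linear[OF D]] by simp
    ultimately have "((\<lambda>s. h (x + s *\<^sub>R (z - x))) has_real_derivative D (z - x)) (at 0)"
      by (simp add: has_field_derivative_def)
    \<comment> \<open>One-sided, because the segment towards \<open>z\<close> is known to stay in
      \<open>S\<close> only for \<open>s\<close> between \<open>0\<close> and
      \<open>1\<close>.\<close>
    then have "((\<lambda>s. (h (x + s *\<^sub>R (z - x)) - h x) / s) \<longlongrightarrow> D (z - x)) (at_right 0)"
      by (simp add: has_field_derivative_iff filterlim_at_split)
    moreover have "eventually (\<lambda>s. (h (x + s *\<^sub>R (z - x)) - h x) / s \<le> 0) (at_right (0::real))"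
      unfolding eventually_at_right_field
    proof (intro exI[of _ 1] conjI allI impI)
      fix s :: real assume s: "0 < s" "s < 1"
      have "x + s *\<^sub>R (z - x) = (1 - s) *\<^sub>R x + s *\<^sub>R z" by (simp add: algebra_simps)
      also have "\<dots> \<in> S" using S s by (intro convexD) auto
      finally show "(h (x + s *\<^sub>R (z - x)) - h x) / s \<le> 0"
        using max s by (simp add: divide_le_0_iff)
    qed simp
    ultimately show ?thesis by (rule tendsto_upperbound) simp
  qed
  ultimately show ?thesis by simp
qed

theorem theorem4p11:
  fixes \<Omega> :: "(real^'d) set"
    and v :: "real^('n::{finite,linorder})"
    and b :: "real^'d^('n::{finite,linorder})"
    and t :: "real^'d"
    and T :: "real^'d^('n::{finite,linorder})"
    and R :: real
    and B :: "(real^'d^('n::{finite,linorder})) set"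
    and Xstar :: "real^'d^('n::{finite,linorder})"
    and H :: "real^'d^('n::{finite,linorder}) \<Rightarrow> real"
  assumes "CARD('d) \<ge> 2"
    and "\<Omega> \<noteq> {}" "convex \<Omega>" "bounded \<Omega>" "\<Omega> = closure (interior \<Omega>)"
    and "(v, b) \<in> compatible_data \<Omega>"
    and "\<not> (\<exists>X\<in>distinct_seeds. \<forall>i. cell_centroid \<Omega> X v i = b $ i)"
    and "T = (\<chi> i. t)"
    and "R > 0"
    and "B = {X. norm (X - T) \<le> R}"
    and "H = H_fun \<Omega> (v, b)"
    and "Xstar \<in> B" "\<forall>X\<in>B. H X \<le> H Xstar"
    and "Xstar \<in> distinct_seeds"
    and "\<exists>U. open U \<and> Xstar \<in> U \<and> Ck_on 3 H U"
    and "dim (hessian_kernel H Xstar) = 1 + CARD('d)"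
  shows "local_minimiser_on
           (\<lambda>X. \<Sum>i\<in>UNIV. (v $ i)\<^sup>2 * (norm (cell_centroid \<Omega> X v i - b $ i))\<^sup>2)
           distinct_seeds Xstar"
proof -
  let ?P = "centroid_gap \<Omega> v b"
  have \<Omega>: "compact \<Omega>"
    using assms(4,5) by (metis closed_closure compact_eq_bounded_closed)
  have v: "v \<in> target_volumes \<Omega>" using assms(6) by (auto simp: compatible_data_def)
  note le = H_fun_le_gap[OF \<Omega> _ v, of _ b, folded \<open>H = H_fun \<Omega> (v, b)\<close>]
  note eq = H_fun_eq_gap[OF \<Omega> \<open>Xstar \<in> distinct_seeds\<close> v, of b, folded \<open>H = H_fun \<Omega> (v, b)\<close>]
  have orth: "?P X \<bullet> (Xstar - T) = ?P X \<bullet> Xstar" if "X \<in> distinct_seeds" for X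
    using centroid_gap_orthogonal_translations[OF \<Omega> that assms(6), of t]
    by (simp add: inner_diff_right \<open>T = _\<close>)
  have diff: "H differentiable (at Xstar)"
    using assms(15) by (auto simp: numeral_3_eq_3)
  have B: "B = cball T R" using assms(10) by (auto simp: dist_norm norm_minus_commute)
  have crit: "R * norm (?P Xstar) \<le> ?P Xstar \<bullet> (Xstar - T)"
  proof (cases "?P Xstar = 0")
    case False
    \<comment> \<open>The point of the ball where the linear functional given by
      \<open>?P Xstar\<close> is largest; its value there relative to \<open>T\<close> is
      \<open>R * norm (?P Xstar)\<close>.\<close>
    let ?z = "T + (R / norm (?P Xstar)) *\<^sub>R ?P Xstar"
    have "?P Xstar \<bullet> (?z - Xstar) \<le> 0"
    proof (rule inner_le_of_maximal_supergradient[OF diff])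
      show "H y \<le> H Xstar + ?P Xstar \<bullet> (y - Xstar)" for y
        using le[OF \<open>Xstar \<in> distinct_seeds\<close>, of y] eq by (simp add: inner_diff_right)
      show "convex B" by (simp add: B)
      show "?z \<in> B" using False \<open>R > 0\<close> by (simp add: B dist_norm)
    qed (use assms(12,13) in auto)
    moreover have "?P Xstar \<bullet> ((R / norm (?P Xstar)) *\<^sub>R ?P Xstar) = R * norm (?P Xstar)"
      by (simp add: power2_norm_eq_inner[symmetric] power2_eq_square)
    ultimately show ?thesis by (simp add: inner_diff_right inner_add_right)
  qed simp
  have min: "norm (?P Xstar) \<le> norm (?P X)" if X: "X \<in> distinct_seeds" for X
  proof -
    have "R * norm (?P Xstar) \<le> ?P Xstar \<bullet> Xstar"
      using crit orth[OF assms(14)] by simp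
    \<comment> \<open>Recentring at \<open>T\<close> through \<open>orth\<close> matters: the
      Cauchy-Schwarz step below then involves \<open>norm (Xstar - T)\<close>, which is at most
      \<open>R\<close>.\<close>
    also have "\<dots> \<le> ?P X \<bullet> (Xstar - T)"
      using le[OF X, of Xstar] eq orth[OF X] by simp
    also have "\<dots> \<le> norm (?P X) * norm (Xstar - T)" by (rule norm_cauchy_schwarz)
    also have "\<dots> \<le> norm (?P X) * R"
      using assms(10,12) by (intro mult_left_mono) auto
    finally show ?thesis using \<open>R > 0\<close> by (simp add: mult.commute)
  qed
  \<comment> \<open>The comparison \<open>min\<close> holds for all distinct seeds, so the radius
    \<open>1\<close> is an arbitrary choice.\<close>
  show ?thesis
    unfolding local_minimiser_on_def norm_centroid_gap[symmetric]
    using assms(14) min by (auto intro!: exI[of _ 1] power_mono)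
qed

end
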